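(* Let $(X,d)$ be an ultrametric space whose value set $\Gamma$ is linearly ordered, and let $(X,\mathcal{B}_d)$ be its ultrametric ball space. Then: 1) the ball space $(X,\operatorname{ci}(\mathcal{B}_d))$ is chain intersection closed; 2) if $(X,\mathcal{B}_d)$ is spherically complete, then so is $(X,\operatorname{ci}(\mathcal{B}_d))$.
   Context: A ball space $(X,\mathcal{B})$ is a nonempty set $X$ with a nonempty collection $\mathcal{B}$ of nonempty subsets of $X$. A chain in $\mathcal{B}$ is a nonempty subset of $\mathcal{B}$ linearly ordered by inclusion. $(X,\mathcal{B})$ is spherically complete if every chain in $\mathcal{B}$ has nonempty intersection. $\operatorname{ci}(\mathcal{B})$ is the family of all nonempty sets of the form $\bigcap\mathcal{C}$ with $\mathcal{C}\subseteq\mathcal{B}$ a (nonempty) chain. $(X,\mathcal{B})$ is chain intersection closed if the intersection of every chain in $\mathcal{B}$ is empty or belongs to $\mathcal{B}$, i.e. $\operatorname{ci}(\mathcal{B})=\mathcal{B}$. An ultrametric on $X$ is a map $d:X\times X\to\Gamma$, $\Gamma$ a poset with least element $\bot$, such that for all $x,y,z\in X$, $\gamma\in\Gamma$: $d(x,y)=\bot$ iff $x=y$; if $d(x,y)\le\gamma$ and $d(y,z)\le\gamma$ then $d(x,z)\le\gamma$; $d(x,y)=d(y,x)$. For $x,y\in X$, $B(x,y)=\{z\in X: d(x,z)\le d(x,y)\}$, and $\mathcal{B}_d=\{B(x,y):x,y\in X\}$. *)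

theory Defs
  imports Main
begin

definition ball_space :: "'a set \<Rightarrow> 'a set set \<Rightarrow> bool" where
  "ball_space X \<B> \<longleftrightarrow> X \<noteq> {} \<and> \<B> \<noteq> {} \<and> (\<forall>B\<in>\<B>. B \<noteq> {} \<and> B \<subseteq> X)"

(* The library's chains include the empty one, whose intersection would be UNIV. *)
definition nonempty_chains :: "'a set set \<Rightarrow> 'a set set set" where
  "nonempty_chains \<B> = {\<C> \<in> chains \<B>. \<C> \<noteq> {}}"

definition spherically_complete :: "'a set \<Rightarrow> 'a set set \<Rightarrow> bool" where
  "spherically_complete X \<B> \<longleftrightarrow>
     ball_space X \<B> \<and> (\<forall>\<C> \<in> nonempty_chains \<B>. \<Inter>\<C> \<noteq> {})"

definition ci :: "'a set set \<Rightarrow> 'a set set" where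
  "ci \<B> = {\<Inter>\<C> |\<C>. \<C> \<in> nonempty_chains \<B> \<and> \<Inter>\<C> \<noteq> {}}"

definition chain_intersection_closed :: "'a set \<Rightarrow> 'a set set \<Rightarrow> bool" where
  "chain_intersection_closed X \<B> \<longleftrightarrow>
     ball_space X \<B> \<and> (\<forall>\<C> \<in> nonempty_chains \<B>. \<Inter>\<C> = {} \<or> \<Inter>\<C> \<in> \<B>)"

(* The value set is the poset with carrier \<Gamma>, order relation r and least element least. *)
definition ultrametric_space ::
  "'a set \<Rightarrow> 'g set \<Rightarrow> 'g rel \<Rightarrow> 'g \<Rightarrow> ('a \<Rightarrow> 'a \<Rightarrow> 'g) \<Rightarrow> bool" where
  "ultrametric_space X \<Gamma> r least d \<longleftrightarrow>
     X \<noteq> {} \<and>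
     partial_order_on \<Gamma> r \<and> least \<in> \<Gamma> \<and> (\<forall>\<gamma>\<in>\<Gamma>. (least, \<gamma>) \<in> r) \<and>
     (\<forall>x\<in>X. \<forall>y\<in>X. d x y \<in> \<Gamma>) \<and>
     (\<forall>x\<in>X. \<forall>y\<in>X. d x y = least \<longleftrightarrow> x = y) \<and>
     (\<forall>x\<in>X. \<forall>y\<in>X. \<forall>z\<in>X. \<forall>\<gamma>\<in>\<Gamma>.
        (d x y, \<gamma>) \<in> r \<longrightarrow> (d y z, \<gamma>) \<in> r \<longrightarrow> (d x z, \<gamma>) \<in> r) \<and>
     (\<forall>x\<in>X. \<forall>y\<in>X. d x y = d y x)"

definition ultrametric_ball ::
  "'a set \<Rightarrow> 'g rel \<Rightarrow> ('a \<Rightarrow> 'a \<Rightarrow> 'g) \<Rightarrow> 'a \<Rightarrow> 'a \<Rightarrow> 'a set" where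
  "ultrametric_ball X r d x y = {z \<in> X. (d x z, d x y) \<in> r}"

definition ultrametric_balls ::
  "'a set \<Rightarrow> 'g rel \<Rightarrow> ('a \<Rightarrow> 'a \<Rightarrow> 'g) \<Rightarrow> 'a set set" where
  "ultrametric_balls X r d = {ultrametric_ball X r d x y |x y. x \<in> X \<and> y \<in> X}"

lemma ball_space_ultrametric_balls:
  assumes "ultrametric_space X \<Gamma> r least d"
  shows "ball_space X (ultrametric_balls X r d)"
proof -
  have ne: "X \<noteq> {}"
    and mem: "\<And>x y. x \<in> X \<Longrightarrow> y \<in> X \<Longrightarrow> d x y \<in> \<Gamma>"
    and po: "partial_order_on \<Gamma> r"
    using assms unfolding ultrametric_space_def by blast+
  have "y \<in> ultrametric_ball X r d x y" if "x \<in> X" "y \<in> X" for x y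
    using that mem[OF that] po
    by (simp add: ultrametric_ball_def partial_order_on_def preorder_on_def refl_on_def)
  moreover have "ultrametric_ball X r d x y \<subseteq> X" for x y
    by (auto simp: ultrametric_ball_def)
  ultimately show ?thesis
    using ne unfolding ball_space_def ultrametric_balls_def by blast
qed

lemma subset_ci: "ball_space X \<B> \<Longrightarrow> \<B> \<subseteq> ci \<B>"
proof
  fix B assume "ball_space X \<B>" "B \<in> \<B>"
  then have "{B} \<in> nonempty_chains \<B>" "B = \<Inter>{B}" "\<Inter>{B} \<noteq> {}"
    by (auto simp: nonempty_chains_def chains_def chain_subset_def ball_space_def)
  then show "B \<in> ci \<B>"
    unfolding ci_def by blast
qed

lemma ball_space_ci:
  assumes "ball_space X \<B>"
  shows "ball_space X (ci \<B>)"
proof -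
  have "B \<noteq> {} \<and> B \<subseteq> X" if B: "B \<in> ci \<B>" for B
  proof -
    obtain \<C> where C: "B = \<Inter>\<C>" "\<C> \<in> nonempty_chains \<B>" "\<Inter>\<C> \<noteq> {}"
      using B unfolding ci_def by blast
    then obtain A where "A \<in> \<C>" "A \<in> \<B>"
      unfolding nonempty_chains_def chains_def by blast
    then show ?thesis
      using C assms unfolding ball_space_def by blast
  qed
  then show ?thesis
    using assms subset_ci[OF assms] unfolding ball_space_def by blast
qed

lemma chain_intersection_closed_iff_ci:
  assumes "ball_space X \<B>"
  shows "chain_intersection_closed X \<B> \<longleftrightarrow> ci \<B> = \<B>"
  using assms subset_ci[OF assms]
  unfolding chain_intersection_closed_def ci_def by blast

end

theory Submission
  imports Defs
begin

text \<open>
  When the value set is linearly ordered, two intersecting balls are comparable by inclusion.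
  Given a chain of chain intersections of balls, any two members are nonempty and comparable, hence
  intersect; so any two balls containing members of the chain intersect and are comparable. The
  balls containing some member of the chain thus form a chain of balls with the same intersection.
\<close>

lemma ultrametric_space_dist_in:
  assumes "ultrametric_space X \<Gamma> r least d"
  shows "\<forall>x\<in>X. \<forall>y\<in>X. d x y \<in> \<Gamma>"
  using assms unfolding ultrametric_space_def by (elim conjE)

lemma ultrametric_space_triangle:
  assumes "ultrametric_space X \<Gamma> r least d"
  shows "\<forall>x\<in>X. \<forall>y\<in>X. \<forall>z\<in>X. \<forall>\<gamma>\<in>\<Gamma>.
    (d x y, \<gamma>) \<in> r \<longrightarrow> (d y z, \<gamma>) \<in> r \<longrightarrow> (d x z, \<gamma>) \<in> r"
  using assms unfolding ultrametric_space_def by (elim conjE)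

lemma ultrametric_space_sym:
  assumes "ultrametric_space X \<Gamma> r least d"
  shows "\<forall>x\<in>X. \<forall>y\<in>X. d x y = d y x"
  using assms unfolding ultrametric_space_def by (elim conjE)

text \<open>The common point \<open>z\<close> links the two centres: \<open>d u z\<close>,
  \<open>d z x\<close> and \<open>d x w\<close> are all bounded by the larger radius
  \<open>d u v\<close>, so two applications of the triangle condition lead from \<open>u\<close>
  over \<open>z\<close> and \<open>x\<close> to any \<open>w\<close> in the smaller ball.\<close>

lemma ultrametric_ball_mono_if_inter:
  assumes U: "ultrametric_space X \<Gamma> r least d"
    and X: "x \<in> X" "y \<in> X" "u \<in> X" "v \<in> X"
    and z: "z \<in> ultrametric_ball X r d x y" "z \<in> ultrametric_ball X r d u v"
    and le: "(d x y, d u v) \<in> r"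
  shows "ultrametric_ball X r d x y \<subseteq> ultrametric_ball X r d u v"
proof
  fix w assume w: "w \<in> ultrametric_ball X r d x y"
  have trans: "trans r"
    using U by (simp add: ultrametric_space_def partial_order_on_def preorder_on_def)
  \<comment> \<open>The triangle condition at the fixed bound \<open>d u v\<close>, which is a
    legitimate bound because it lies in \<open>\<Gamma>\<close>.\<close>
  have tri: "(d a c, d u v) \<in> r"
    if "a \<in> X" "b \<in> X" "c \<in> X" "(d a b, d u v) \<in> r" "(d b c, d u v) \<in> r" for a b c
    using ultrametric_space_triangle[OF U] ultrametric_space_dist_in[OF U] X that by metis
  have mem: "z \<in> X" "w \<in> X"
    using z w by (auto simp: ultrametric_ball_def)
  have "(d x z, d x y) \<in> r" "(d x w, d x y) \<in> r" and uz: "(d u z, d u v) \<in> r"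
    using z w by (auto simp: ultrametric_ball_def)
  then have xz: "(d x z, d u v) \<in> r" and xw: "(d x w, d u v) \<in> r"
    using le transD[OF trans] by metis+
  have "d z x = d x z"
    using ultrametric_space_sym[OF U] X mem by metis
  then have "(d u x, d u v) \<in> r"
    using tri[of u z x] X mem uz xz by simp
  then have "(d u w, d u v) \<in> r"
    using tri[of u x w] X mem xw by simp
  then show "w \<in> ultrametric_ball X r d u v"
    using mem by (simp add: ultrametric_ball_def)
qed

text \<open>Linearity makes the two radii comparable, and the ball with the smaller radius is then
  contained in the other.\<close>

lemma ultrametric_balls_comparable:
  assumes U: "ultrametric_space X \<Gamma> r least d" and lin: "linear_order_on \<Gamma> r"
    and A: "A \<in> ultrametric_balls X r d" and B: "B \<in> ultrametric_balls X r d"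
    and inter: "A \<inter> B \<noteq> {}"
  shows "A \<subseteq> B \<or> B \<subseteq> A"
proof -
  obtain x y where A': "A = ultrametric_ball X r d x y" "x \<in> X" "y \<in> X"
    using A unfolding ultrametric_balls_def by blast
  obtain u v where B': "B = ultrametric_ball X r d u v" "u \<in> X" "v \<in> X"
    using B unfolding ultrametric_balls_def by blast
  obtain z where z: "z \<in> A" "z \<in> B"
    using inter by blast
  have mem: "d x y \<in> \<Gamma>" "d u v \<in> \<Gamma>"
    using ultrametric_space_dist_in[OF U] A' B' by metis+
  \<comment> \<open>Totality speaks only of distinct values; reflexivity covers equal radii.\<close>
  have "refl_on \<Gamma> r" "total_on \<Gamma> r"
    using lin by (auto simp: linear_order_on_def partial_order_on_def preorder_on_def)
  then have "(d x y, d u v) \<in> r \<or> (d u v, d x y) \<in> r"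
    using mem by (metis refl_onD total_on_def)
  then show ?thesis
    using ultrametric_ball_mono_if_inter[OF U A'(2,3) B'(2,3), of z]
      ultrametric_ball_mono_if_inter[OF U B'(2,3) A'(2,3), of z] z
    unfolding A'(1) B'(1) by blast
qed

text \<open>This flattens a chain of intersections into one chain of members of \<open>\<B>\<close>.
  Comparability of intersecting members is the only property of balls that enters.\<close>

lemma nonempty_chain_of_ci_has_same_Inter:
  assumes comparable: "\<And>A B. A \<in> \<B> \<Longrightarrow> B \<in> \<B> \<Longrightarrow> A \<inter> B \<noteq> {} \<Longrightarrow> A \<subseteq> B \<or> B \<subseteq> A"
    and C: "\<C> \<in> nonempty_chains (ci \<B>)"
  obtains \<D> where "\<D> \<in> nonempty_chains \<B>" "\<Inter>\<D> = \<Inter>\<C>"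
proof
  \<comment> \<open>Taking every member of \<open>\<B>\<close> above some member of
    \<open>\<C>\<close> avoids choosing a representing chain for each \<open>I\<close>.\<close>
  let ?D = "{B \<in> \<B>. \<exists>I\<in>\<C>. I \<subseteq> B}"
  have chain: "I \<subseteq> J \<or> J \<subseteq> I" if "I \<in> \<C>" "J \<in> \<C>" for I J
    using C that by (auto simp: nonempty_chains_def chains_def chain_subset_def)
  have ci: "I \<noteq> {} \<and> (\<exists>\<E>\<subseteq>\<B>. \<E> \<noteq> {} \<and> I = \<Inter>\<E>)" if "I \<in> \<C>" for I
  proof -
    have "I \<in> ci \<B>"
      using C that by (auto simp: nonempty_chains_def chains_def)
    then obtain \<E> where "\<E> \<in> nonempty_chains \<B>" "I = \<Inter>\<E>" "I \<noteq> {}"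
      unfolding ci_def by blast
    then show ?thesis
      unfolding nonempty_chains_def chains_def by blast
  qed
  have "A \<subseteq> B \<or> B \<subseteq> A" if A: "A \<in> ?D" and B: "B \<in> ?D" for A B
  proof -
    obtain I J where IJ: "I \<in> \<C>" "J \<in> \<C>" "I \<subseteq> A" "J \<subseteq> B"
      using A B by blast
    have "I \<noteq> {}" "J \<noteq> {}"
      using ci IJ by simp_all
    \<comment> \<open>The smaller of \<open>I\<close> and \<open>J\<close> is nonempty and lies in
      both \<open>A\<close> and \<open>B\<close>.\<close>
    then have "A \<inter> B \<noteq> {}"
      using chain[OF IJ(1,2)] IJ(3,4) by blast
    then show ?thesis
      using comparable A B by blast
  qed
  moreover have "?D \<noteq> {}"
  proof -
    obtain I where I: "I \<in> \<C>"
      using C by (auto simp: nonempty_chains_def)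
    then obtain \<E> where "\<E> \<subseteq> \<B>" "\<E> \<noteq> {}" "I = \<Inter>\<E>"
      using ci by meson
    then show ?thesis
      using I by blast
  qed
  ultimately show "?D \<in> nonempty_chains \<B>"
    unfolding nonempty_chains_def chains_def chain_subset_def by blast
  \<comment> \<open>Each member of a family \<open>\<E>\<close> with intersection \<open>I\<close>
    contains \<open>I\<close>, so \<open>\<E>\<close> is part of \<open>?D\<close>. The reverse
    inclusion holds because each member of \<open>?D\<close> contains some member of
    \<open>\<C>\<close>.\<close>
  have "\<Inter>?D \<subseteq> I" if I: "I \<in> \<C>" for I
  proof -
    obtain \<E> where "\<E> \<subseteq> \<B>" "\<E> \<noteq> {}" "I = \<Inter>\<E>"
      using ci I by meson
    then show ?thesis
      using I by blast
  qed
  then show "\<Inter>?D = \<Inter>\<C>"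
    by blast
qed

theorem theorem1p1:
  fixes X :: "'a set" and \<Gamma> :: "'g set" and r :: "'g rel" and least :: 'g
    and d :: "'a \<Rightarrow> 'a \<Rightarrow> 'g"
  assumes "ultrametric_space X \<Gamma> r least d"
    and "linear_order_on \<Gamma> r"
  shows "chain_intersection_closed X (ci (ultrametric_balls X r d)) \<and>
    (spherically_complete X (ultrametric_balls X r d) \<longrightarrow>
      spherically_complete X (ci (ultrametric_balls X r d)))"
proof -
  let ?B = "ultrametric_balls X r d"
  have same: "\<exists>\<D>\<in>nonempty_chains ?B. \<Inter>\<D> = \<Inter>\<C>" if "\<C> \<in> nonempty_chains (ci ?B)" for \<C>
    using nonempty_chain_of_ci_has_same_Inter[OF ultrametric_balls_comparable[OF assms] that]
    by metis
  have ball: "ball_space X (ci ?B)"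
    by (rule ball_space_ci[OF ball_space_ultrametric_balls[OF assms(1)]])
  \<comment> \<open>If the intersection is nonempty, the flattened chain \<open>\<D>\<close> itself
    witnesses membership in \<open>ci ?B\<close>.\<close>
  have "\<Inter>\<C> = {} \<or> \<Inter>\<C> \<in> ci ?B" if C: "\<C> \<in> nonempty_chains (ci ?B)" for \<C>
  proof -
    obtain \<D> where "\<D> \<in> nonempty_chains ?B" "\<Inter>\<D> = \<Inter>\<C>"
      using same[OF C] by blast
    then show ?thesis
      unfolding ci_def mem_Collect_eq by metis
  qed
  moreover have "\<Inter>\<C> \<noteq> {}"
    if "spherically_complete X ?B" "\<C> \<in> nonempty_chains (ci ?B)" for \<C>
    using same[OF that(2)] that(1) unfolding spherically_complete_def by metis
  ultimately show ?thesis
    using ball by (simp add: chain_intersection_closed_def spherically_complete_def)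
qed

end
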